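(* Let $\mathbb{T}$ be a $\mathcal{V}_{\mathsf{Node}}$-structure and $\mathcal{H}$ a $\mathbb{T}$-proof space. Then $\mathcal{L}(\mathcal{H})$ is closed under $\simeq$ on words: if $\rho\in\mathcal{L}(\mathcal{H})$ and $\rho'\in(\Sigma\times\mathbb{T})^*$ with $\rho'\simeq\rho$, then $\rho'\in\mathcal{L}(\mathcal{H})$.
   Context: For a structure and a set $V$ of elements, $N(V)$ is the substructure generated by $V$; $N(\vec a)$ is that of the set of entries of a tuple $\vec a$; juxtaposition of tuples denotes concatenation. For tuples $\vec a,\vec b$ of equal length in $\mathbb{T}$, a local isomorphism from $\vec a$ to $\vec b$ is an isomorphism $\beta:N(\vec a)\to N(\vec b)$ with $\beta(\vec a)=\vec b$; $\vec a\simeq\vec b$ if one exists. $\Sigma$ is a finite set of commands and $\mathcal{V}_{\mathsf{Data}}$ a vocabulary for data. On words, $\langle\sigma_1:v_1\rangle\cdots\langle\sigma_n:v_n\rangle\simeq\langle\sigma'_1:v'_1\rangle\cdots\langle\sigma'_{n'}:v'_{n'}\rangle$ iff $(\sigma_1,\dots,\sigma_n)=(\sigma'_1,\dots,\sigma'_{n'})$ and $(v_1,\dots,v_n)\simeq(v'_1,\dots,v'_n)$. Hoare triples over $\Sigma\times\mathbb{T}$ have the form $\{A\}\,\rho\,\{B\}$ with $\rho\in(\Sigma\times\mathbb{T})^*$ and assertions $A,B$ of the form $\phi[\mu(u_1),\dots,\mu(u_m)]$ ($\phi$ a $\mathcal{V}_{\mathsf{Data}}$-formula, $u_j\in\mathbb{T}$,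 $\mu$ a formal unary symbol); assertions are viewed as conjunctions of their conjuncts. Rules: Sequencing — from $\{A_1\}\rho_1\{A_2\}$ and $\{A_2'\}\rho_2\{A_3\}$, where every conjunct of $A_2'$ is a conjunct of $A_2$, derive $\{A_1\}\rho_1\rho_2\{A_3\}$; Conjunction — from $\{A_1\}\rho\{B_1\}$ and $\{A_2\}\rho\{B_2\}$ derive $\{A_1\wedge A_2\}\rho\{B_1\wedge B_2\}$; S-param — from $\{\phi[\overrightarrow{\mu(u)}]\}\langle\sigma_1:v_1\rangle\cdots\langle\sigma_n:v_n\rangle\{\psi[\overrightarrow{\mu(w)}]\}$ derive $\{\phi[\overrightarrow{\mu(u')}]\}\langle\sigma_1:v'_1\rangle\cdots\langle\sigma_n:v'_n\rangle\{\psi[\overrightarrow{\mu(w')}]\}$ whenever $|\vec u|=|\vec u'|$, $|\vec w|=|\vec w'|$ and $\vec u\vec v\vec w\simeq\vec u'\vec v'\vec w'$ in $\mathbb{T}$. A $\mathbb{T}$-proof space is a set of Hoare triples closed under these three rules. Its language is $\mathcal{L}(\mathcal{H})=\{\rho\in(\Sigma\times\mathbb{T})^*:\{\top\}\rho\{\bot\}\in\mathcal{H}\}$. *)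

theory Defs
  imports Main
begin

section \<open>Vocabularies, structures and local isomorphisms\<close>

text \<open>Constants are function symbols of arity 0.\<close>

record ('f, 'r) vocab =
  fun_syms :: "'f set"
  fun_arity :: "'f \<Rightarrow> nat"
  rel_syms :: "'r set"
  rel_arity :: "'r \<Rightarrow> nat"

record ('f, 'r, 'a) struct =
  universe :: "'a set"
  fun_interp :: "'f \<Rightarrow> 'a list \<Rightarrow> 'a"
  rel_interp :: "'r \<Rightarrow> 'a list set"

definition tuples :: "'a set \<Rightarrow> nat \<Rightarrow> 'a list set" where
  "tuples S n = {xs. set xs \<subseteq> S \<and> length xs = n}"

definition fun_closed :: "('f, 'r) vocab \<Rightarrow> ('f, 'r, 'a) struct \<Rightarrow> 'a set \<Rightarrow> bool" where
  "fun_closed V T S \<longleftrightarrow>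
    (\<forall>f\<in>fun_syms V. \<forall>xs\<in>tuples S (fun_arity V f). fun_interp T f xs \<in> S)"

definition is_structure :: "('f, 'r) vocab \<Rightarrow> ('f, 'r, 'a) struct \<Rightarrow> bool" where
  "is_structure V T \<longleftrightarrow>
    fun_closed V T (universe T) \<and>
    (\<forall>r\<in>rel_syms V. rel_interp T r \<subseteq> tuples (universe T) (rel_arity V r))"

definition generated_substructure ::
  "('f, 'r) vocab \<Rightarrow> ('f, 'r, 'a) struct \<Rightarrow> 'a set \<Rightarrow> ('f, 'r, 'a) struct" where
  "generated_substructure V T X =
    (let S = \<Inter>{S. X \<subseteq> S \<and> S \<subseteq> universe T \<and> fun_closed V T S}
     in \<lparr>universe = S, fun_interp = fun_interp T,
         rel_interp = (\<lambda>r. rel_interp T r \<inter> lists S)\<rparr>)"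

definition isomorphism ::
  "('f, 'r) vocab \<Rightarrow> ('f, 'r, 'a) struct \<Rightarrow> ('f, 'r, 'b) struct \<Rightarrow> ('a \<Rightarrow> 'b) \<Rightarrow> bool" where
  "isomorphism V A B \<beta> \<longleftrightarrow>
    bij_betw \<beta> (universe A) (universe B) \<and>
    (\<forall>f\<in>fun_syms V. \<forall>xs\<in>tuples (universe A) (fun_arity V f).
      \<beta> (fun_interp A f xs) = fun_interp B f (map \<beta> xs)) \<and>
    (\<forall>r\<in>rel_syms V. \<forall>xs\<in>tuples (universe A) (rel_arity V r).
      xs \<in> rel_interp A r \<longleftrightarrow> map \<beta> xs \<in> rel_interp B r)"

definition local_isomorphism ::
  "('f, 'r) vocab \<Rightarrow> ('f, 'r, 'a) struct \<Rightarrow> 'a list \<Rightarrow> 'a list \<Rightarrow> ('a \<Rightarrow> 'a) \<Rightarrow> bool" where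
  "local_isomorphism V T as bs \<beta> \<longleftrightarrow>
    isomorphism V (generated_substructure V T (set as)) (generated_substructure V T (set bs)) \<beta> \<and>
    map \<beta> as = bs"

definition tuple_equiv ::
  "('f, 'r) vocab \<Rightarrow> ('f, 'r, 'a) struct \<Rightarrow> 'a list \<Rightarrow> 'a list \<Rightarrow> bool" where
  "tuple_equiv V T as bs \<longleftrightarrow>
    set as \<subseteq> universe T \<and> set bs \<subseteq> universe T \<and> length as = length bs \<and>
    (\<exists>\<beta>. local_isomorphism V T as bs \<beta>)"

type_synonym ('c, 'a) word = "('c \<times> 'a) list"

definition word_equiv ::
  "('f, 'r) vocab \<Rightarrow> ('f, 'r, 'a) struct \<Rightarrow> ('c, 'a) word \<Rightarrow> ('c, 'a) word \<Rightarrow> bool" where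
  "word_equiv V T \<rho> \<rho>' \<longleftrightarrow>
    map fst \<rho> = map fst \<rho>' \<and> tuple_equiv V T (map snd \<rho>) (map snd \<rho>')"


section \<open>Formulas and assertions\<close>

text \<open>
  First-order formulas with equality, in de Bruijn representation. The additional leaves
  \<open>Mu u\<close> stand for the formal terms \<open>\<mu>(u)\<close>; they do not occur in formulas over the data
  vocabulary, only in the assertions obtained from these by instantiation.
\<close>

datatype ('f, 'a) trm = Var nat | Mu 'a | App 'f "('f, 'a) trm list"

datatype ('f, 'r, 'a) fm =
    Tru | Fls
  | Eq "('f, 'a) trm" "('f, 'a) trm"
  | Rel 'r "('f, 'a) trm list"
  | Neg "('f, 'r, 'a) fm"
  | Conj "('f, 'r, 'a) fm" "('f, 'r, 'a) fm"
  | Disj "('f, 'r, 'a) fm" "('f, 'r, 'a) fm"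
  | Imp "('f, 'r, 'a) fm" "('f, 'r, 'a) fm"
  | Ex "('f, 'r, 'a) fm"
  | All "('f, 'r, 'a) fm"

text \<open>
  \<open>data_formula V m \<phi>\<close>: \<open>\<phi>\<close> is a \<open>V\<close>-formula whose free variables are among the first \<open>m\<close>.
\<close>

fun data_term :: "('f, 'r) vocab \<Rightarrow> nat \<Rightarrow> ('f, 'a) trm \<Rightarrow> bool" where
  "data_term V m (Var i) \<longleftrightarrow> i < m"
| "data_term V m (Mu u) \<longleftrightarrow> False"
| "data_term V m (App f ts) \<longleftrightarrow>
    f \<in> fun_syms V \<and> length ts = fun_arity V f \<and> (\<forall>t\<in>set ts. data_term V m t)"

fun data_formula :: "('f, 'r) vocab \<Rightarrow> nat \<Rightarrow> ('f, 'r, 'a) fm \<Rightarrow> bool" where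
  "data_formula V m Tru \<longleftrightarrow> True"
| "data_formula V m Fls \<longleftrightarrow> True"
| "data_formula V m (Eq s t) \<longleftrightarrow> data_term V m s \<and> data_term V m t"
| "data_formula V m (Rel r ts) \<longleftrightarrow>
    r \<in> rel_syms V \<and> length ts = rel_arity V r \<and> (\<forall>t\<in>set ts. data_term V m t)"
| "data_formula V m (Neg \<phi>) \<longleftrightarrow> data_formula V m \<phi>"
| "data_formula V m (Conj \<phi> \<psi>) \<longleftrightarrow> data_formula V m \<phi> \<and> data_formula V m \<psi>"
| "data_formula V m (Disj \<phi> \<psi>) \<longleftrightarrow> data_formula V m \<phi> \<and> data_formula V m \<psi>"
| "data_formula V m (Imp \<phi> \<psi>) \<longleftrightarrow> data_formula V m \<phi> \<and> data_formula V m \<psi>"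
| "data_formula V m (Ex \<phi>) \<longleftrightarrow> data_formula V (Suc m) \<phi>"
| "data_formula V m (All \<phi>) \<longleftrightarrow> data_formula V (Suc m) \<phi>"

text \<open>
  Below \<open>k\<close> quantifiers the \<open>i\<close>-th free variable has index \<open>k + i\<close>; it is replaced by
  \<open>Mu (us ! i)\<close>. The instances \<open>Mu u\<close> are closed, so no shifting is needed.
\<close>

fun inst_term :: "nat \<Rightarrow> 'a list \<Rightarrow> ('f, 'a) trm \<Rightarrow> ('f, 'a) trm" where
  "inst_term k us (Var i) = (if i < k then Var i else Mu (us ! (i - k)))"
| "inst_term k us (Mu u) = Mu u"
| "inst_term k us (App f ts) = App f (map (inst_term k us) ts)"

fun inst_under :: "nat \<Rightarrow> 'a list \<Rightarrow> ('f, 'r, 'a) fm \<Rightarrow> ('f, 'r, 'a) fm" where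
  "inst_under k us Tru = Tru"
| "inst_under k us Fls = Fls"
| "inst_under k us (Eq s t) = Eq (inst_term k us s) (inst_term k us t)"
| "inst_under k us (Rel r ts) = Rel r (map (inst_term k us) ts)"
| "inst_under k us (Neg \<phi>) = Neg (inst_under k us \<phi>)"
| "inst_under k us (Conj \<phi> \<psi>) = Conj (inst_under k us \<phi>) (inst_under k us \<psi>)"
| "inst_under k us (Disj \<phi> \<psi>) = Disj (inst_under k us \<phi>) (inst_under k us \<psi>)"
| "inst_under k us (Imp \<phi> \<psi>) = Imp (inst_under k us \<phi>) (inst_under k us \<psi>)"
| "inst_under k us (Ex \<phi>) = Ex (inst_under (Suc k) us \<phi>)"
| "inst_under k us (All \<phi>) = All (inst_under (Suc k) us \<phi>)"

definition inst :: "('f, 'r, 'a) fm \<Rightarrow> 'a list \<Rightarrow> ('f, 'r, 'a) fm" where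
  "inst \<phi> us = inst_under 0 us \<phi>"

definition assertions ::
  "('f, 'r) vocab \<Rightarrow> ('nf, 'nr, 'a) struct \<Rightarrow> ('f, 'r, 'a) fm set" where
  "assertions V T =
    {inst \<phi> us | \<phi> us. data_formula V (length us) \<phi> \<and> set us \<subseteq> universe T}"

fun conjuncts :: "('f, 'r, 'a) fm \<Rightarrow> ('f, 'r, 'a) fm set" where
  "conjuncts (Conj A B) = conjuncts A \<union> conjuncts B"
| "conjuncts A = {A}"


section \<open>Proof spaces\<close>

type_synonym ('c, 'f, 'r, 'a) triple =
  "('f, 'r, 'a) fm \<times> ('c, 'a) word \<times> ('f, 'r, 'a) fm"

definition words :: "'c set \<Rightarrow> ('nf, 'nr, 'a) struct \<Rightarrow> ('c, 'a) word set" where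
  "words \<Sigma> T = lists (\<Sigma> \<times> universe T)"

definition hoare_triples ::
  "('f, 'r) vocab \<Rightarrow> 'c set \<Rightarrow> ('nf, 'nr, 'a) struct \<Rightarrow> ('c, 'f, 'r, 'a) triple set" where
  "hoare_triples VData \<Sigma> T = assertions VData T \<times> words \<Sigma> T \<times> assertions VData T"

definition closed_sequencing :: "('c, 'f, 'r, 'a) triple set \<Rightarrow> bool" where
  "closed_sequencing H \<longleftrightarrow>
    (\<forall>A\<^sub>1 \<rho>\<^sub>1 A\<^sub>2 A\<^sub>2' \<rho>\<^sub>2 A\<^sub>3.
      (A\<^sub>1, \<rho>\<^sub>1, A\<^sub>2) \<in> H \<longrightarrow> (A\<^sub>2', \<rho>\<^sub>2, A\<^sub>3) \<in> H \<longrightarrow> conjuncts A\<^sub>2' \<subseteq> conjuncts A\<^sub>2 \<longrightarrow>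
      (A\<^sub>1, \<rho>\<^sub>1 @ \<rho>\<^sub>2, A\<^sub>3) \<in> H)"

definition closed_conjunction :: "('c, 'f, 'r, 'a) triple set \<Rightarrow> bool" where
  "closed_conjunction H \<longleftrightarrow>
    (\<forall>A\<^sub>1 A\<^sub>2 \<rho> B\<^sub>1 B\<^sub>2.
      (A\<^sub>1, \<rho>, B\<^sub>1) \<in> H \<longrightarrow> (A\<^sub>2, \<rho>, B\<^sub>2) \<in> H \<longrightarrow> (Conj A\<^sub>1 A\<^sub>2, \<rho>, Conj B\<^sub>1 B\<^sub>2) \<in> H)"

definition closed_s_param ::
  "('nf, 'nr) vocab \<Rightarrow> ('f, 'r) vocab \<Rightarrow> ('nf, 'nr, 'a) struct \<Rightarrow>
    ('c, 'f, 'r, 'a) triple set \<Rightarrow> bool" where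
  "closed_s_param VNode VData T H \<longleftrightarrow>
    (\<forall>\<phi> \<psi> us us' ws ws' \<sigma>s vs vs'.
      data_formula VData (length us) \<phi> \<longrightarrow> data_formula VData (length ws) \<psi> \<longrightarrow>
      length vs = length \<sigma>s \<longrightarrow> length vs' = length \<sigma>s \<longrightarrow>
      length us = length us' \<longrightarrow> length ws = length ws' \<longrightarrow>
      tuple_equiv VNode T (us @ vs @ ws) (us' @ vs' @ ws') \<longrightarrow>
      (inst \<phi> us, zip \<sigma>s vs, inst \<psi> ws) \<in> H \<longrightarrow>
      (inst \<phi> us', zip \<sigma>s vs', inst \<psi> ws') \<in> H)"

definition proof_space ::
  "('nf, 'nr) vocab \<Rightarrow> ('f, 'r) vocab \<Rightarrow> 'c set \<Rightarrow> ('nf, 'nr, 'a) struct \<Rightarrow>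
    ('c, 'f, 'r, 'a) triple set \<Rightarrow> bool" where
  "proof_space VNode VData \<Sigma> T H \<longleftrightarrow>
    H \<subseteq> hoare_triples VData \<Sigma> T \<and>
    closed_sequencing H \<and> closed_conjunction H \<and> closed_s_param VNode VData T H"

definition language ::
  "'c set \<Rightarrow> ('nf, 'nr, 'a) struct \<Rightarrow> ('c, 'f, 'r, 'a) triple set \<Rightarrow> ('c, 'a) word set" where
  "language \<Sigma> T H = {\<rho> \<in> words \<Sigma> T. (Tru, \<rho>, Fls) \<in> H}"

end

theory Submission
  imports Defs
begin

text \<open>
  The assertions \<open>\<top>\<close> and \<open>\<bottom>\<close> have no parameters, so the parameter condition of S-param
  reduces to equivalence of the words themselves. The rule transports a triple from \<open>\<rho>\<close> to \<open>\<rho>'\<close>,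
  whereas the hypothesis is \<open>\<rho>' \<simeq> \<rho>\<close>; hence the symmetry of \<open>\<simeq>\<close> is needed.
\<close>

text \<open>An intersection of closed sets is closed; for an empty family it is \<open>UNIV\<close>,
  which is closed too.\<close>

lemma fun_closed_generated_substructure:
  "fun_closed V (generated_substructure V T X) (universe (generated_substructure V T X))"
  unfolding generated_substructure_def Let_def fun_closed_def tuples_def
  by (auto simp: subset_iff)

text \<open>Each clause for the inverse is the clause for \<open>\<beta>\<close> at the pulled-back
  tuple. Closure of \<open>A\<close> is a separate assumption, since \<open>isomorphism\<close> does
  not include it.\<close>

lemma isomorphism_inv_into:
  assumes iso: "isomorphism V A B \<beta>" and closed: "fun_closed V A (universe A)"
  shows "isomorphism V B A (inv_into (universe A) \<beta>)"
proof -
  let ?g = "inv_into (universe A) \<beta>"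
  have bij: "bij_betw \<beta> (universe A) (universe B)"
    using iso by (simp add: isomorphism_def)
  have g_bij: "bij_betw ?g (universe B) (universe A)"
    using bij by (rule bij_betw_inv_into)
  have map_g: "map ?g xs \<in> tuples (universe A) n" "map \<beta> (map ?g xs) = xs"
    if "xs \<in> tuples (universe B) n" for xs n
    using that bij g_bij
    by (auto simp: tuples_def bij_betw_inv_into_right subset_iff bij_betw_apply intro!: map_idI)
  have "?g (fun_interp B f xs) = fun_interp A f (map ?g xs)"
    if f: "f \<in> fun_syms V" and xs: "xs \<in> tuples (universe B) (fun_arity V f)" for f xs
  proof -
    have "\<beta> (fun_interp A f (map ?g xs)) = fun_interp B f (map \<beta> (map ?g xs))"
      using iso f map_g(1)[OF xs] unfolding isomorphism_def by blast
    then have "\<beta> (fun_interp A f (map ?g xs)) = fun_interp B f xs"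
      by (simp only: map_g(2)[OF xs])
    \<comment> \<open>\<open>?g\<close> cancels \<open>\<beta>\<close> only on the universe of
      \<open>A\<close>, so the function value must lie there.\<close>
    moreover have "fun_interp A f (map ?g xs) \<in> universe A"
      using closed f map_g(1)[OF xs] unfolding fun_closed_def by blast
    ultimately show ?thesis
      using bij bij_betw_inv_into_left by metis
  qed
  moreover have "xs \<in> rel_interp B r \<longleftrightarrow> map ?g xs \<in> rel_interp A r"
    if r: "r \<in> rel_syms V" and xs: "xs \<in> tuples (universe B) (rel_arity V r)" for r xs
  proof -
    have "map ?g xs \<in> rel_interp A r \<longleftrightarrow> map \<beta> (map ?g xs) \<in> rel_interp B r"
      using iso r map_g(1)[OF xs] unfolding isomorphism_def by blast
    then show ?thesis
      by (simp only: map_g(2)[OF xs])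
  qed
  ultimately show ?thesis
    using g_bij unfolding isomorphism_def by blast
qed

text \<open>The inverse of a local isomorphism is one in the other direction: the entries of
  \<open>as\<close> are among the generators, where \<open>inv_into\<close> undoes
  \<open>\<beta>\<close>.\<close>

lemma tuple_equiv_sym:
  assumes "tuple_equiv V T as bs"
  shows "tuple_equiv V T bs as"
proof -
  let ?A = "generated_substructure V T (set as)"
  obtain \<beta> where iso: "isomorphism V ?A (generated_substructure V T (set bs)) \<beta>"
    and bs: "map \<beta> as = bs"
    using assms unfolding tuple_equiv_def local_isomorphism_def by blast
  have "set as \<subseteq> universe ?A"
    unfolding generated_substructure_def Let_def by auto
  moreover have "inj_on \<beta> (universe ?A)"
    using iso unfolding isomorphism_def bij_betw_def by blast
  ultimately have "map (inv_into (universe ?A) \<beta>) bs = as"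
    unfolding bs[symmetric] map_map by (intro map_idI) (simp add: subset_iff)
  then have "local_isomorphism V T bs as (inv_into (universe ?A) \<beta>)"
    using isomorphism_inv_into[OF iso fun_closed_generated_substructure]
    unfolding local_isomorphism_def by blast
  then show ?thesis
    using assms unfolding tuple_equiv_def by auto
qed

theorem theorem5p6:
  fixes VNode :: "('nf, 'nr) vocab"
    and VData :: "('f, 'r) vocab"
    and \<Sigma> :: "'c set"
    and T :: "('nf, 'nr, 'a) struct"
    and H :: "('c, 'f, 'r, 'a) triple set"
    and \<rho> \<rho>' :: "('c, 'a) word"
  assumes "finite \<Sigma>"
    and "is_structure VNode T"
    and "proof_space VNode VData \<Sigma> T H"
    and "\<rho> \<in> language \<Sigma> T H"
    and "\<rho>' \<in> words \<Sigma> T"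
    and "word_equiv VNode T \<rho>' \<rho>"
  shows "\<rho>' \<in> language \<Sigma> T H"
proof -
  have fst_eq: "map fst \<rho>' = map fst \<rho>"
    and equiv: "tuple_equiv VNode T (map snd \<rho>) (map snd \<rho>')"
    using assms(6) by (auto simp: word_equiv_def intro: tuple_equiv_sym)
  have triple: "(Tru, \<rho>, Fls) \<in> H"
    using assms(4) by (simp add: language_def)
  \<comment> \<open>This is the shape S-param expects: \<open>us\<close> and \<open>ws\<close>
    empty, and the commands of \<open>\<rho>\<close> paired with the data of
    \<open>\<rho>'\<close>.\<close>
  have "(inst Tru [], zip (map fst \<rho>) (map snd \<rho>'), inst Fls []) \<in> H"
  proof -
    have "closed_s_param VNode VData T H"
      using assms(3) by (simp add: proof_space_def)
    moreover have "length (map snd \<rho>') = length (map fst \<rho>)"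
      using fst_eq by (metis length_map)
    moreover have "(inst Tru [], zip (map fst \<rho>) (map snd \<rho>), inst Fls []) \<in> H"
      using triple by (simp add: inst_def zip_map_fst_snd)
    ultimately show ?thesis
      using equiv unfolding closed_s_param_def
      by (metis append_Nil append_Nil2 data_formula.simps(1,2) length_map)
  qed
  \<comment> \<open>Both words carry the same commands, so the zipped word is \<open>\<rho>'\<close>
    itself.\<close>
  then have "(Tru, \<rho>', Fls) \<in> H"
    by (simp add: inst_def zip_map_fst_snd flip: fst_eq)
  then show ?thesis
    using assms(5) by (simp add: language_def)
qed

end
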